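(* Let $\bm c_1,\dots,\bm c_k,\bm d_1,\dots,\bm d_m\in\mathbb R^{2^n}$ with $m\ge1$. The following two statements are equivalent: (i) for all $\bm h\in\overline{\Gamma}_n^*$: $\ \bigwedge_{i\in[k]}(\bm c_i\cdot\bm h\ge0)\ \Rightarrow\ \bigvee_{j\in[m]}(\bm d_j\cdot\bm h\ge0)$; (ii) there exist $\lambda_1,\dots,\lambda_m\ge0$ with $\sum_{j}\lambda_j=1$ such that for all $\bm h\in\overline{\Gamma}_n^*$: $\ \bigwedge_{i\in[k]}(\bm c_i\cdot\bm h\ge0)\ \Rightarrow\ \sum_{j\in[m]}\lambda_j\,\bm d_j\cdot\bm h\ge0$.
   Context: All logarithms are in base 2. A random variable $X$ with finite domain $D$ and probability mass function $p$ has entropy $H(X)=-\sum_{x\in D}p(x)\log p(x)$. Given a joint distribution of $n$ random variables $X_1,\dots,X_n$ with finite domains, its entropic vector is $\bm h=(h(\alpha))_{\alpha\subseteq[n]}\in\mathbb R_+^{2^n}$, where $h(\alpha)=H((X_i)_{i\in\alpha})$ and $h(\emptyset)=0$. $\Gamma_n^*$ denotes the set of all entropic vectors and $\overline{\Gamma}_n^*$ its topological closure, the set of almost-entropic vectors. For $\bm c,\bm h\in\mathbb R^{2^n}$, $\bm c\cdot\bm h=\sum_{\alpha\subseteq[n]}c_\alpha h(\alpha)$. *)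

theory Defs
  imports "HOL-Probability.Probability"
begin

definition pmf_entropy :: "'a pmf \<Rightarrow> real" where
  "pmf_entropy p = - (\<Sum>x\<in>set_pmf p. pmf p x * log 2 (pmf p x))"

lemma pmf_entropy_eq_sum:
  assumes "finite D" "set_pmf p \<subseteq> D"
  shows "pmf_entropy p = - (\<Sum>x\<in>D. pmf p x * log 2 (pmf p x))"
proof -
  have "(\<Sum>x\<in>set_pmf p. pmf p x * log 2 (pmf p x)) = (\<Sum>x\<in>D. pmf p x * log 2 (pmf p x))"
    by (rule sum.mono_neutral_left) (use assms in \<open>auto simp: set_pmf_iff\<close>)
  then show ?thesis by (simp add: pmf_entropy_def)
qed

lemma pmf_entropy_map_inj:
  assumes "inj_on f (set_pmf p)"
  shows "pmf_entropy (map_pmf f p) = pmf_entropy p"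
  using assms by (simp add: pmf_entropy_def sum.reindex pmf_map_inj)

definition marginal_pmf :: "'n set \<Rightarrow> ('n \<Rightarrow> 'a) pmf \<Rightarrow> ('n \<Rightarrow> 'a) pmf" where
  "marginal_pmf \<alpha> p = map_pmf (\<lambda>x. restrict x \<alpha>) p"

definition entropic_vector :: "('n::finite \<Rightarrow> 'a) pmf \<Rightarrow> real ^ ('n set)" where
  "entropic_vector p = (\<chi> \<alpha>. pmf_entropy (marginal_pmf \<alpha> p))"

lemma entropic_vector_empty: "entropic_vector p $ {} = 0"
proof -
  have "marginal_pmf {} p = return_pmf (\<lambda>_. undefined)"
    by (simp add: marginal_pmf_def restrict_def)
  then show ?thesis by (simp add: entropic_vector_def pmf_entropy_def)
qed

(* Entropies do not depend on the names of the values, so letting every variable take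
   values in a finite set of natural numbers is no restriction: see
   entropic_vector_in_entropic_vectors. *)
definition entropic_vectors :: "(real ^ ('n::finite set)) set" where
  "entropic_vectors = {entropic_vector p | (p :: ('n \<Rightarrow> nat) pmf) D.
     (\<forall>i. finite (D i)) \<and> (\<forall>x\<in>set_pmf p. \<forall>i. x i \<in> D i)}"

lemma entropic_vector_in_entropic_vectors:
  fixes p :: "('n::finite \<Rightarrow> 'a) pmf" and D :: "'n \<Rightarrow> 'a set"
  assumes D: "\<And>i. finite (D i)" and p: "\<And>x i. x \<in> set_pmf p \<Longrightarrow> x i \<in> D i"
  shows "entropic_vector p \<in> entropic_vectors"
proof -
  have "\<exists>f. inj_on f (D i) \<and> f ` D i \<subseteq> (UNIV :: nat set)" for i
    using finite_imp_inj_to_nat_seg[OF D[of i]] by blast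
  then obtain f :: "'n \<Rightarrow> 'a \<Rightarrow> nat" where f: "\<And>i. inj_on (f i) (D i)"
    by metis
  define q where "q = map_pmf (\<lambda>x i. f i (x i)) p"
  have "pmf_entropy (marginal_pmf \<alpha> q) = pmf_entropy (marginal_pmf \<alpha> p)" for \<alpha>
  proof -
    let ?g = "\<lambda>x. restrict (\<lambda>i. f i (x i)) \<alpha>"
    have "marginal_pmf \<alpha> q = map_pmf ?g (marginal_pmf \<alpha> p)"
      unfolding q_def marginal_pmf_def pmf.map_comp
      by (intro map_pmf_cong refl) (auto simp: restrict_def fun_eq_iff)
    moreover have "inj_on ?g (set_pmf (marginal_pmf \<alpha> p))"
    proof (rule inj_onI)
      fix x y
      assume x: "x \<in> set_pmf (marginal_pmf \<alpha> p)" and y: "y \<in> set_pmf (marginal_pmf \<alpha> p)"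
        and eq: "?g x = ?g y"
      obtain x' where x': "x' \<in> set_pmf p" "x = restrict x' \<alpha>"
        using x by (auto simp: marginal_pmf_def)
      obtain y' where y': "y' \<in> set_pmf p" "y = restrict y' \<alpha>"
        using y by (auto simp: marginal_pmf_def)
      show "x = y"
      proof
        fix i
        show "x i = y i"
        proof (cases "i \<in> \<alpha>")
          case True
          then have "f i (x' i) = f i (y' i)"
            using fun_cong[OF eq, of i] x' y' by simp
          then have "x' i = y' i"
            using f[of i] p[OF x'(1)] p[OF y'(1)] by (meson inj_onD)
          then show ?thesis using x' y' True by simp
        qed (use x' y' in simp)
      qed
    qed
    ultimately show ?thesis by (simp add: pmf_entropy_map_inj)
  qed
  then have "entropic_vector p = entropic_vector q"
    by (simp add: entropic_vector_def)
  moreover have "\<forall>i. finite (f i ` D i)" using D by simp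
  moreover have "\<forall>x\<in>set_pmf q. \<forall>i. x i \<in> f i ` D i" using p by (auto simp: q_def)
  ultimately show ?thesis
    unfolding entropic_vectors_def
    by (intro CollectI exI[of _ q] exI[of _ "\<lambda>i. f i ` D i"] conjI)
qed

definition almost_entropic_vectors :: "(real ^ ('n::finite set)) set" where
  "almost_entropic_vectors = closure entropic_vectors"

end

theory Submission
  imports Defs "HOL-Real_Asymp.Real_Asymp"
begin

text \<open>The almost-entropic vectors form a closed convex cone: independent pairing adds entropic
  vectors, and revealing \<open>N\<close> independent copies of the variables only with probability \<open>t / N\<close>
  realises \<open>t *\<^sub>R h\<close> up to the entropy of a single bit, which vanishes as \<open>N\<close> grows. Intersecting with
  the half-spaces of the \<open>c i\<close> gives a closed convex cone \<open>K\<close>. If the convex hull of the \<open>d j\<close> missed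
  the dual cone of \<open>K\<close>, a hyperplane separating the two would have a normal in the double dual, which
  is \<open>K\<close>, and this normal would be negative on every \<open>d j\<close>.\<close>

section \<open>Entropic vectors\<close>

lemma pmf_entropy_pair_pmf:
  assumes fp: "finite (set_pmf p)" and fq: "finite (set_pmf q)"
  shows "pmf_entropy (pair_pmf p q) = pmf_entropy p + pmf_entropy q"
proof -
  have "(\<Sum>z\<in>set_pmf (pair_pmf p q). pmf (pair_pmf p q) z * log 2 (pmf (pair_pmf p q) z))
      = (\<Sum>x\<in>set_pmf p. \<Sum>y\<in>set_pmf q. pmf p x * pmf q y * log 2 (pmf p x * pmf q y))"
    unfolding set_pair_pmf sum.cartesian_product by (intro sum.cong) (auto simp: pmf_pair)
  also have "\<dots> = (\<Sum>x\<in>set_pmf p. \<Sum>y\<in>set_pmf q.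
      pmf p x * log 2 (pmf p x) * pmf q y + pmf p x * (pmf q y * log 2 (pmf q y)))"
    by (intro sum.cong refl) (simp add: log_mult pmf_positive algebra_simps)
  also have "\<dots> = (\<Sum>x\<in>set_pmf p. pmf p x * log 2 (pmf p x)) * (\<Sum>y\<in>set_pmf q. pmf q y)
      + (\<Sum>x\<in>set_pmf p. pmf p x) * (\<Sum>y\<in>set_pmf q. pmf q y * log 2 (pmf q y))"
    by (simp add: sum.distrib sum_product)
  finally show ?thesis
    using sum_pmf_eq_1[OF fp order_refl] sum_pmf_eq_1[OF fq order_refl]
    by (simp add: pmf_entropy_def)
qed

text \<open>Since \<open>z\<close> lies outside the support of \<open>P\<close>, the outcome reveals
  the coin. The chain rule then gives the entropy of the coin plus \<open>t\<close> times that of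
  \<open>P\<close>; the point mass adds nothing.\<close>

lemma pmf_entropy_mixture_return:
  assumes fin: "finite (set_pmf P)" and z: "z \<notin> set_pmf P" and t: "0 < t" "t < 1"
  shows "pmf_entropy (bernoulli_pmf t \<bind> (\<lambda>b. if b then P else return_pmf z))
      = t * pmf_entropy P - t * log 2 t - (1 - t) * log 2 (1 - t)"
proof -
  define R where "R = bernoulli_pmf t \<bind> (\<lambda>b. if b then P else return_pmf z)"
  have R: "pmf R x = t * pmf P x + (1 - t) * (if x = z then 1 else 0)" for x
    using t by (simp add: R_def pmf_bind pmf_return indicator_def)
  have sub: "set_pmf R \<subseteq> insert z (set_pmf P)"
    unfolding R_def by (auto split: if_splits)
  have "pmf_entropy R = - (\<Sum>x\<in>insert z (set_pmf P). pmf R x * log 2 (pmf R x))"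
    using fin sub by (intro pmf_entropy_eq_sum) auto
  also have "\<dots> = - (1 - t) * log 2 (1 - t) - (\<Sum>x\<in>set_pmf P. pmf R x * log 2 (pmf R x))"
    using fin z by (simp add: R set_pmf_iff algebra_simps)
  also have "(\<Sum>x\<in>set_pmf P. pmf R x * log 2 (pmf R x))
      = (\<Sum>x\<in>set_pmf P. t * log 2 t * pmf P x + t * (pmf P x * log 2 (pmf P x)))"
  proof (intro sum.cong refl)
    fix x assume x: "x \<in> set_pmf P"
    with z have "pmf R x = t * pmf P x" by (auto simp: R)
    with x t show "pmf R x * log 2 (pmf R x)
        = t * log 2 t * pmf P x + t * (pmf P x * log 2 (pmf P x))"
      by (simp add: log_mult pmf_positive algebra_simps)
  qed
  also have "\<dots> = t * log 2 t + t * (\<Sum>x\<in>set_pmf P. pmf P x * log 2 (pmf P x))"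
    using sum_pmf_eq_1[OF fin order_refl] by (simp add: sum.distrib flip: sum_distrib_left)
  finally show ?thesis by (simp add: pmf_entropy_def[of P] algebra_simps flip: R_def)
qed

lemma finite_set_pmf_of_coordinates:
  fixes p :: "('n::finite \<Rightarrow> 'a) pmf"
  assumes "\<And>i. finite (D i)" and "\<And>x i. x \<in> set_pmf p \<Longrightarrow> x i \<in> D i"
  shows "finite (set_pmf p)"
proof (rule finite_subset)
  show "set_pmf p \<subseteq> Pi\<^sub>E UNIV D" using assms(2) by auto
  show "finite (Pi\<^sub>E UNIV D)" using assms(1) by (intro finite_PiE) auto
qed

lemma entropic_vectors_cases:
  fixes h :: "real ^ ('n::finite set)"
  assumes "h \<in> entropic_vectors"
  obtains p :: "('n \<Rightarrow> nat) pmf" and D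
  where "h = entropic_vector p" "\<And>i. finite (D i)" "\<And>x i. x \<in> set_pmf p \<Longrightarrow> x i \<in> D i"
    "finite (set_pmf p)"
proof -
  obtain p :: "('n \<Rightarrow> nat) pmf" and D where *: "h = entropic_vector p" "\<And>i. finite (D i)"
    "\<And>x i. x \<in> set_pmf p \<Longrightarrow> x i \<in> D i"
    using assms unfolding entropic_vectors_def by blast
  then show ?thesis using that finite_set_pmf_of_coordinates[of D p] by blast
qed

section \<open>Sums and thinnings of entropic vectors\<close>

lemma entropic_vectors_zero: "0 \<in> (entropic_vectors :: (real ^ ('n::finite set)) set)"
proof -
  have "entropic_vector (return_pmf (\<lambda>_::'n. 0::nat)) \<in> entropic_vectors"
    by (rule entropic_vector_in_entropic_vectors[where D = "\<lambda>_. {0}"]) auto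
  moreover have "entropic_vector (return_pmf (\<lambda>_::'n. 0::nat)) = 0"
    by (simp add: entropic_vector_def marginal_pmf_def pmf_entropy_def vec_eq_iff)
  ultimately show ?thesis by simp
qed

text \<open>Pairing two independent families coordinatewise makes each marginal an injective
  relabelling of the product of the two marginals, whose entropies add.\<close>

lemma entropic_vectors_add:
  fixes g h :: "real ^ ('n::finite set)"
  assumes "g \<in> entropic_vectors" "h \<in> entropic_vectors"
  shows "g + h \<in> entropic_vectors"
proof -
  from assms(1) obtain p :: "('n \<Rightarrow> nat) pmf" and D where p: "g = entropic_vector p"
    "\<And>i. finite (D i)" "\<And>x i. x \<in> set_pmf p \<Longrightarrow> x i \<in> D i" "finite (set_pmf p)"
    by (rule entropic_vectors_cases) blast
  from assms(2) obtain q :: "('n \<Rightarrow> nat) pmf" and E where q: "h = entropic_vector q"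
    "\<And>i. finite (E i)" "\<And>x i. x \<in> set_pmf q \<Longrightarrow> x i \<in> E i" "finite (set_pmf q)"
    by (rule entropic_vectors_cases) blast
  define r where "r = map_pmf (\<lambda>(x, y) i. (x i, y i)) (pair_pmf p q)"
  have "pmf_entropy (marginal_pmf \<alpha> r)
      = pmf_entropy (marginal_pmf \<alpha> p) + pmf_entropy (marginal_pmf \<alpha> q)" for \<alpha>
  proof -
    let ?f = "\<lambda>(x, y). restrict (\<lambda>i. (x i, y i)) \<alpha>"
    have "marginal_pmf \<alpha> r
        = map_pmf ?f (map_pmf (\<lambda>(x, y). (restrict x \<alpha>, restrict y \<alpha>)) (pair_pmf p q))"
      unfolding r_def marginal_pmf_def pmf.map_comp
      by (intro map_pmf_cong refl) (auto simp: restrict_def fun_eq_iff)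
    also have "\<dots> = map_pmf ?f (pair_pmf (marginal_pmf \<alpha> p) (marginal_pmf \<alpha> q))"
      by (simp add: map_pair marginal_pmf_def)
    finally have "marginal_pmf \<alpha> r = \<dots>" .
    moreover have "inj_on ?f (set_pmf (pair_pmf (marginal_pmf \<alpha> p) (marginal_pmf \<alpha> q)))"
    proof (rule inj_onI, clarify)
      fix x y x' y'
      assume mem: "(x, y) \<in> set_pmf (pair_pmf (marginal_pmf \<alpha> p) (marginal_pmf \<alpha> q))"
          "(x', y') \<in> set_pmf (pair_pmf (marginal_pmf \<alpha> p) (marginal_pmf \<alpha> q))"
        and eq: "restrict (\<lambda>i. (x i, y i)) \<alpha> = restrict (\<lambda>i. (x' i, y' i)) \<alpha>"
      \<comment> \<open>Restricted functions are all \<open>undefined\<close> outside \<alpha>, so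
        agreement on \<alpha> suffices for equality.\<close>
      have ext: "x \<in> extensional \<alpha>" "y \<in> extensional \<alpha>" "x' \<in> extensional \<alpha>" "y' \<in> extensional \<alpha>"
        using mem by (auto simp: marginal_pmf_def)
      have "x i = x' i \<and> y i = y' i" if "i \<in> \<alpha>" for i
        using fun_cong[OF eq, of i] that by simp
      with ext show "x = x' \<and> y = y'" by (metis extensionalityI)
    qed
    ultimately show ?thesis
      using p(4) q(4) by (simp add: pmf_entropy_map_inj pmf_entropy_pair_pmf marginal_pmf_def)
  qed
  then have "g + h = entropic_vector r"
    by (simp add: p(1) q(1) entropic_vector_def vec_eq_iff)
  also have "\<dots> \<in> entropic_vectors"
    by (rule entropic_vector_in_entropic_vectors[where D = "\<lambda>i. D i \<times> E i"])
      (use p q in \<open>auto simp: r_def\<close>)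
  finally show ?thesis .
qed

lemma entropic_vectors_of_nat:
  assumes "h \<in> entropic_vectors"
  shows "real N *\<^sub>R h \<in> entropic_vectors"
  by (induction N) (auto simp: entropic_vectors_zero scaleR_left_distrib assms entropic_vectors_add)

text \<open>One common coin shows all variables with probability \<open>t\<close> and sets all of
  them to \<open>None\<close> otherwise. Every nonempty \<alpha> sees the coin, hence the binary
  entropy of \<open>t\<close> as an extra term. The vector it multiplies is the entropic vector of a
  single fair bit copied to all variables.\<close>

lemma entropic_vectors_thinning:
  fixes h :: "real ^ ('n::finite set)"
  assumes "h \<in> entropic_vectors" and t: "0 < t" "t < 1"
  shows "t *\<^sub>R h + (- t * log 2 t - (1 - t) * log 2 (1 - t)) *\<^sub>R (\<chi> \<alpha>. if \<alpha> = {} then 0 else 1)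
    \<in> entropic_vectors" (is "?g \<in> _")
proof -
  from assms(1) obtain p :: "('n \<Rightarrow> nat) pmf" and D where p: "h = entropic_vector p"
    "\<And>i. finite (D i)" "\<And>x i. x \<in> set_pmf p \<Longrightarrow> x i \<in> D i" "finite (set_pmf p)"
    by (rule entropic_vectors_cases) blast
  define r where "r = bernoulli_pmf t \<bind>
    (\<lambda>b. if b then map_pmf (\<lambda>x i. Some (x i)) p else return_pmf (\<lambda>_. None))"
  have "entropic_vector r $ \<alpha> = ?g $ \<alpha>" for \<alpha>
  \<comment> \<open>The empty marginal cannot see the coin: there both branches restrict to the same
    function, so the mixture formula would not apply.\<close>
  proof (cases "\<alpha> = {}")
    case True
    then show ?thesis by (simp add: entropic_vector_empty p(1))
  next
    case False
    then obtain i where i: "i \<in> \<alpha>" by blast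
    let ?f = "\<lambda>x. restrict (\<lambda>i. Some (x i)) \<alpha>"
    let ?P = "map_pmf ?f (marginal_pmf \<alpha> p)"
    let ?z = "restrict (\<lambda>_. None) \<alpha>"
    have P: "map_pmf (\<lambda>x. restrict x \<alpha>) (map_pmf (\<lambda>x i. Some (x i)) p) = ?P"
      unfolding marginal_pmf_def pmf.map_comp
      by (intro map_pmf_cong refl) (auto simp: restrict_def fun_eq_iff)
    have "marginal_pmf \<alpha> r = bernoulli_pmf t \<bind> (\<lambda>b. if b then ?P else return_pmf ?z)"
      unfolding r_def marginal_pmf_def[of \<alpha> "_ \<bind> _"] map_bind_pmf
      by (intro bind_pmf_cong refl) (simp add: P)
    \<comment> \<open>Coordinate \<open>i\<close> is \<open>None\<close> in \<open>?z\<close> but a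
      \<open>Some\<close> value throughout the support of \<open>?P\<close>.\<close>
    moreover have "?z \<notin> set_pmf ?P"
      using i by (auto dest!: fun_cong[of _ _ i])
    moreover have "finite (set_pmf ?P)"
      using p(4) by (simp add: marginal_pmf_def)
    moreover have "inj_on ?f (set_pmf (marginal_pmf \<alpha> p))"
    proof (rule inj_onI)
      fix x y assume mem: "x \<in> set_pmf (marginal_pmf \<alpha> p)" "y \<in> set_pmf (marginal_pmf \<alpha> p)"
        and eq: "?f x = ?f y"
      have "x \<in> extensional \<alpha>" "y \<in> extensional \<alpha>"
        using mem by (auto simp: marginal_pmf_def)
      moreover have "x i = y i" if "i \<in> \<alpha>" for i
        using fun_cong[OF eq, of i] that by simp
      ultimately show "x = y" by (rule extensionalityI)
    qed
    ultimately show ?thesis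
      using t False
      by (simp add: entropic_vector_def pmf_entropy_mixture_return pmf_entropy_map_inj p(1))
  qed
  then have "?g = entropic_vector r" by (simp add: vec_eq_iff)
  also have "\<dots> \<in> entropic_vectors"
    by (rule entropic_vector_in_entropic_vectors[where D = "\<lambda>i. insert None (Some ` D i)"])
      (use p in \<open>auto simp: r_def split: if_splits\<close>)
  finally show ?thesis .
qed

section \<open>The closed convex cone of almost-entropic vectors\<close>

lemma almost_entropic_vectors_scale_entropic:
  fixes h :: "real ^ ('n::finite set)"
  assumes h: "h \<in> entropic_vectors" and t: "t \<ge> 0"
  shows "t *\<^sub>R h \<in> almost_entropic_vectors"
proof (cases "t = 0")
  case True
  then show ?thesis
    using closure_subset entropic_vectors_zero by (auto simp: almost_entropic_vectors_def)
next
  case False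
  with t have t: "t > 0" by simp
  \<comment> \<open>Thinning \<open>real N *\<^sub>R h\<close> with probability \<open>s N\<close>
    yields exactly \<open>t *\<^sub>R h\<close> plus an error, the binary entropy of
    \<open>s N\<close>, which tends to 0.\<close>
  define s where "s N = t / real N" for N
  let ?u = "\<chi> \<alpha>. if \<alpha> = {} then 0 else 1"
  define g where "g N = t *\<^sub>R h + (- s N * log 2 (s N) - (1 - s N) * log 2 (1 - s N)) *\<^sub>R ?u" for N
  have "(\<lambda>N. - s N * log 2 (s N) - (1 - s N) * log 2 (1 - s N)) \<longlonglongrightarrow> 0"
    unfolding s_def log_def using t by real_asymp
  then have "g \<longlonglongrightarrow> t *\<^sub>R h + 0 *\<^sub>R ?u"
    unfolding g_def by (intro tendsto_intros)
  then have lim: "g \<longlonglongrightarrow> t *\<^sub>R h" by simp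
  have "\<forall>\<^sub>F N in sequentially. s N < 1"
    unfolding s_def using t by real_asymp
  then have ev: "\<forall>\<^sub>F N in sequentially. g N \<in> almost_entropic_vectors"
    using eventually_gt_at_top[of 0]
  proof eventually_elim
    case (elim N)
    \<comment> \<open>\<open>N > 0\<close> gives both \<open>s N > 0\<close> and
      \<open>s N * real N = t\<close>.\<close>
    have "g N \<in> entropic_vectors"
      using entropic_vectors_thinning[OF entropic_vectors_of_nat[OF h, of N], of "s N"] elim t
      by (simp add: g_def s_def)
    then show ?case using closure_subset by (auto simp: almost_entropic_vectors_def)
  qed
  show ?thesis
    by (rule Lim_in_closed_set[OF _ ev _ lim]) (auto simp: almost_entropic_vectors_def)
qed

text \<open>Scaling is continuous, so the vectors that it sends into the closed set form a closed
  set; this contains the entropic vectors and hence their closure.\<close>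

lemma almost_entropic_vectors_scale:
  assumes "h \<in> almost_entropic_vectors" "t \<ge> 0"
  shows "t *\<^sub>R h \<in> almost_entropic_vectors"
proof -
  have "closed ((\<lambda>x. t *\<^sub>R x) -` almost_entropic_vectors)"
    by (intro continuous_closed_vimage)
      (auto simp: almost_entropic_vectors_def intro!: continuous_intros)
  then have "closure entropic_vectors \<subseteq> (\<lambda>x. t *\<^sub>R x) -` almost_entropic_vectors"
    using almost_entropic_vectors_scale_entropic[OF _ assms(2)] by (intro closure_minimal) auto
  then show ?thesis using assms(1) by (auto simp: almost_entropic_vectors_def)
qed

lemma almost_entropic_vectors_add:
  assumes "g \<in> almost_entropic_vectors" "h \<in> almost_entropic_vectors"
  shows "g + h \<in> almost_entropic_vectors"
proof -
  obtain x y where x: "\<And>n. x n \<in> entropic_vectors" "x \<longlonglongrightarrow> g"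
    and y: "\<And>n. y n \<in> entropic_vectors" "y \<longlonglongrightarrow> h"
    using assms unfolding almost_entropic_vectors_def closure_sequential by blast
  have "(\<lambda>n. x n + y n) \<longlonglongrightarrow> g + h"
    using x(2) y(2) by (rule tendsto_add)
  moreover have "x n + y n \<in> entropic_vectors" for n
    using x(1) y(1) by (rule entropic_vectors_add)
  ultimately show ?thesis
    unfolding almost_entropic_vectors_def closure_sequential
    by (intro exI[of _ "\<lambda>n. x n + y n"]) simp
qed

lemma closed_almost_entropic_vectors: "closed almost_entropic_vectors"
  by (simp add: almost_entropic_vectors_def)

lemma convex_cone_almost_entropic_vectors: "convex_cone almost_entropic_vectors"
proof -
  have "0 \<in> almost_entropic_vectors"
    using entropic_vectors_zero closure_subset by (auto simp: almost_entropic_vectors_def)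
  then show ?thesis
    using almost_entropic_vectors_add almost_entropic_vectors_scale
    by (auto simp: convex_cone_iff)
qed

section \<open>Duality for closed convex cones\<close>

text \<open>A negative value at \<open>x\<close> would be scaled along the ray through
  \<open>x\<close> below any bound.\<close>

lemma cone_bounded_below_imp_nonneg:
  fixes z :: "'a::real_inner"
  assumes "conic K" and lb: "\<And>x. x \<in> K \<Longrightarrow> b < z \<bullet> x" and x: "x \<in> K"
  shows "z \<bullet> x \<ge> 0"
proof (rule ccontr)
  assume neg: "\<not> z \<bullet> x \<ge> 0"
  \<comment> \<open>Chosen so that \<open>z\<close> takes the value
    \<open>- (\<bar>b\<bar> + 1)\<close>, which is below \<open>b\<close>, at
    \<open>s *\<^sub>R x\<close>.\<close>
  define s where "s = (\<bar>b\<bar> + 1) / - (z \<bullet> x)"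
  have "s \<ge> 0" unfolding s_def by (rule divide_nonneg_nonneg) (use neg in auto)
  then have "s *\<^sub>R x \<in> K" using assms(1) x by (simp add: conic_def)
  from lb[OF this] show False using neg by (simp add: s_def)
qed

text \<open>A hyperplane strictly separating \<open>a\<close> from \<open>K\<close> has a normal
  that is nonnegative on \<open>K\<close>, because \<open>K\<close> is a cone, and negative at
  \<open>a\<close>, because \<open>0 \<in> K\<close> forces \<open>b < 0\<close>.\<close>

lemma closed_convex_cone_bidual:
  fixes K :: "'a::euclidean_space set"
  assumes K: "convex_cone K" "closed K"
    and a: "\<And>z. (\<And>x. x \<in> K \<Longrightarrow> z \<bullet> x \<ge> 0) \<Longrightarrow> z \<bullet> a \<ge> 0"
  shows "a \<in> K"
proof (rule ccontr)
  assume "a \<notin> K"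
  then obtain z b where z: "z \<bullet> a < b" "\<And>x. x \<in> K \<Longrightarrow> b < z \<bullet> x"
    using separating_hyperplane_closed_point[of K a] K by (auto simp: convex_cone_def)
  have "0 \<in> K" using K(1) by (simp add: convex_cone_iff)
  with z(2)[of 0] have "b < 0" by simp
  moreover have "z \<bullet> x \<ge> 0" if "x \<in> K" for x
    using cone_bounded_below_imp_nonneg[of K b z x] z(2) that K(1) by (auto simp: convex_cone_def)
  ultimately show False using a[of z] z(1) by fastforce
qed

text \<open>Hull membership gives weights on points, whereas weights on indices are wanted and
  \<open>d\<close> may repeat values. Each point's weight goes to one chosen index.\<close>

lemma convex_hull_image_finite_sum:
  assumes "finite I" "x \<in> convex hull (d ` I)"
  obtains l :: "'i \<Rightarrow> real"
  where "\<And>i. i \<in> I \<Longrightarrow> l i \<ge> 0" "sum l I = 1" "x = (\<Sum>i\<in>I. l i *\<^sub>R d i)"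
proof -
  obtain u where u: "\<And>y. y \<in> d ` I \<Longrightarrow> u y \<ge> 0" "sum u (d ` I) = 1" "(\<Sum>y\<in>d ` I. u y *\<^sub>R y) = x"
    using assms by (auto simp: convex_hull_finite)
  \<comment> \<open>\<open>J\<close> holds exactly one index for each value of \<open>d\<close>; the
    other indices get weight 0.\<close>
  obtain J where J: "J \<subseteq> I" "inj_on d J" "d ` J = d ` I"
    by (metis subset_image_inj order_refl)
  define l where "l i = (if i \<in> J then u (d i) else 0)" for i
  have "sum l I = (\<Sum>i\<in>J. u (d i))"
    using J(1) assms(1) by (simp add: l_def sum.If_cases Int_absorb1 flip: sum.inter_restrict)
  also have "\<dots> = 1" using u(2) J(2) by (simp add: sum.reindex flip: J(3))
  finally have 1: "sum l I = 1" .
  have "(\<Sum>i\<in>I. l i *\<^sub>R d i) = (\<Sum>i\<in>J. l i *\<^sub>R d i)"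
    using J(1) assms(1) by (intro sum.mono_neutral_right) (auto simp: l_def)
  also have "\<dots> = (\<Sum>i\<in>J. u (d i) *\<^sub>R d i)" by (simp add: l_def)
  also have "\<dots> = x" using u(3) J(2) by (simp add: sum.reindex flip: J(3))
  finally have 2: "x = (\<Sum>i\<in>I. l i *\<^sub>R d i)" by simp
  show ?thesis by (rule that[OF _ 1 2]) (use u(1) in \<open>auto simp: l_def\<close>)
qed

lemma closed_convex_cone_disjunction:
  fixes K :: "'a::euclidean_space set" and d :: "'i \<Rightarrow> 'a"
  assumes K: "convex_cone K" "closed K" and I: "finite I" "I \<noteq> {}"
    and dis: "\<And>x. x \<in> K \<Longrightarrow> \<exists>i\<in>I. d i \<bullet> x \<ge> 0"
  obtains l :: "'i \<Rightarrow> real"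
  where "\<And>i. i \<in> I \<Longrightarrow> l i \<ge> 0" "sum l I = 1"
    "\<And>x. x \<in> K \<Longrightarrow> (\<Sum>i\<in>I. l i * (d i \<bullet> x)) \<ge> 0"
proof -
  define K' where "K' = {y. \<forall>x\<in>K. y \<bullet> x \<ge> 0}"
  have K'_eq: "K' = (\<Inter>x\<in>K. {y. x \<bullet> y \<ge> 0})" by (auto simp: K'_def inner_commute)
  have K': "closed K'" "convex K'"
    unfolding K'_eq by (auto intro!: closed_INT convex_INT closed_halfspace_ge convex_halfspace_ge)
  have cone': "conic K'" by (auto simp: conic_def K'_def)
  have "0 \<in> K'" by (simp add: K'_def)
  \<comment> \<open>A common point is a convex combination of the \<open>d i\<close> that is
    nonnegative on \<open>K\<close>, so its coefficients are the weights sought.\<close>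
  have "convex hull (d ` I) \<inter> K' \<noteq> {}"
  proof
    assume "convex hull (d ` I) \<inter> K' = {}"
    then have "\<exists>a b. (\<forall>x\<in>convex hull (d ` I). a \<bullet> x < b) \<and> (\<forall>x\<in>K'. a \<bullet> x > b)"
      using K' I
      by (intro separating_hyperplane_compact_closed)
        (simp_all add: compact_convex_hull finite_imp_compact)
    then obtain a b where a: "\<And>x. x \<in> convex hull (d ` I) \<Longrightarrow> a \<bullet> x < b"
      "\<And>x. x \<in> K' \<Longrightarrow> b < a \<bullet> x"
      by blast
    have "b < 0" using a(2)[OF \<open>0 \<in> K'\<close>] by simp
    \<comment> \<open>The normal \<open>a\<close> is bounded below on the cone \<open>K'\<close>,
      hence nonnegative there, which places it in the double dual of \<open>K\<close>.\<close>
    have "a \<in> K"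
    proof (rule closed_convex_cone_bidual[OF K])
      fix z assume "\<And>x. x \<in> K \<Longrightarrow> z \<bullet> x \<ge> 0"
      then have "z \<in> K'" by (simp add: K'_def)
      then show "z \<bullet> a \<ge> 0"
        using cone_bounded_below_imp_nonneg[OF cone' a(2)] by (simp add: inner_commute[of z])
    qed
    then obtain i where "i \<in> I" "d i \<bullet> a \<ge> 0" using dis by blast
    \<comment> \<open>The hull lies on the side below \<open>b < 0\<close>, so \<open>a\<close> is a
      point of \<open>K\<close> at which every \<open>d i\<close> is negative, against
      \<open>dis\<close>.\<close>
    moreover have "a \<bullet> d i < b" using a(1) \<open>i \<in> I\<close> by (simp add: hull_inc)
    ultimately show False using \<open>b < 0\<close> by (simp add: inner_commute)
  qed
  then obtain y where y: "y \<in> convex hull (d ` I)" "y \<in> K'" by blast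
  obtain l where l: "\<And>i. i \<in> I \<Longrightarrow> l i \<ge> 0" "sum l I = 1" "y = (\<Sum>i\<in>I. l i *\<^sub>R d i)"
    using convex_hull_image_finite_sum[OF I(1) y(1)] by blast
  show ?thesis
    by (rule that[OF l(1,2)]) (use y(2) in \<open>auto simp: K'_def l(3) inner_sum_left\<close>)
qed

section \<open>Equivalence of the disjunction and the weighted inequality\<close>

theorem theorem16:
  fixes c d :: "nat \<Rightarrow> real ^ ('n::finite set)" and k m :: nat
  assumes "m \<ge> 1"
  shows "(\<forall>h \<in> almost_entropic_vectors.
            (\<forall>i\<in>{1..k}. c i \<bullet> h \<ge> 0) \<longrightarrow> (\<exists>j\<in>{1..m}. d j \<bullet> h \<ge> 0))
     \<longleftrightarrow>
         (\<exists>l :: nat \<Rightarrow> real.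
            (\<forall>j\<in>{1..m}. l j \<ge> 0) \<and> (\<Sum>j=1..m. l j) = 1 \<and>
            (\<forall>h \<in> almost_entropic_vectors.
               (\<forall>i\<in>{1..k}. c i \<bullet> h \<ge> 0) \<longrightarrow> (\<Sum>j=1..m. l j * (d j \<bullet> h)) \<ge> 0))"
    (is "?L \<longleftrightarrow> ?R")
proof
  assume L: ?L
  \<comment> \<open>The half-spaces have the origin on their boundary or are the whole space, so
    cutting with them preserves the closed convex cone.\<close>
  define K where "K = almost_entropic_vectors \<inter> (\<Inter>i\<in>{1..k}. {h. c i \<bullet> h \<ge> 0})"
  have "convex_cone K"
    using convex_cone_almost_entropic_vectors by (auto simp: K_def convex_cone_iff inner_right_distrib)
  moreover have "closed K"
    unfolding K_def
    by (intro closed_Int closed_almost_entropic_vectors closed_INT ballI closed_halfspace_ge)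
  ultimately obtain l :: "nat \<Rightarrow> real" where "\<And>j. j \<in> {1..m} \<Longrightarrow> l j \<ge> 0" "(\<Sum>j=1..m. l j) = 1"
    "\<And>h. h \<in> K \<Longrightarrow> (\<Sum>j=1..m. l j * (d j \<bullet> h)) \<ge> 0"
    using closed_convex_cone_disjunction[of K "{1..m}" d] L assms by (auto simp: K_def)
  then show ?R by (intro exI[of _ l]) (auto simp: K_def)
next
  assume ?R
  then obtain l :: "nat \<Rightarrow> real" where l: "\<And>j. j \<in> {1..m} \<Longrightarrow> l j \<ge> 0" "(\<Sum>j=1..m. l j) = 1"
    "\<And>h. h \<in> almost_entropic_vectors \<Longrightarrow> (\<forall>i\<in>{1..k}. c i \<bullet> h \<ge> 0) \<Longrightarrow>
      (\<Sum>j=1..m. l j * (d j \<bullet> h)) \<ge> 0"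
    by blast
  show ?L
  proof (intro ballI impI, rule ccontr)
    fix h assume h: "h \<in> almost_entropic_vectors" "\<forall>i\<in>{1..k}. c i \<bullet> h \<ge> 0"
      and "\<not> (\<exists>j\<in>{1..m}. d j \<bullet> h \<ge> 0)"
    then have neg: "\<And>j. j \<in> {1..m} \<Longrightarrow> d j \<bullet> h < 0" by (simp add: not_le)
    \<comment> \<open>Weights with sum 1 cannot all vanish; one positive weight makes the
      combination strictly negative when every \<open>d j \<bullet> h\<close> is negative.\<close>
    obtain j where j: "j \<in> {1..m}" "l j \<noteq> 0" using l(2) by (metis sum.neutral zero_neq_one)
    have "(\<Sum>j=1..m. l j * (d j \<bullet> h)) < (\<Sum>j=1..m. 0)"
    proof (rule sum_strict_mono_ex1)
      show "\<forall>i\<in>{1..m}. l i * (d i \<bullet> h) \<le> 0"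
        using l(1) neg by (simp add: mult_nonneg_nonpos less_imp_le)
      have "l j > 0" using l(1)[OF j(1)] j(2) by simp
      then show "\<exists>i\<in>{1..m}. l i * (d i \<bullet> h) < 0"
        using neg[OF j(1)] j(1) by (blast intro: mult_pos_neg)
    qed simp
    then show False using l(3)[OF h] by simp
  qed
qed

end
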